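(* Let $m\ge2$ and $n\ge1$ be integers and let $A_1,\ldots,A_m\in\mathbb M_n(\mathbb C)$ each have rank at most one, not all zero. Then \[ \left\|\sum_{k=1}^m A_k\right\|_\infty\le\sqrt m\,\left\|\sum_{k=1}^m|A_k|\right\|_\infty . \] The constant $\sqrt m$ is sharp in the dimension-free sense (i.e. it is the supremum of $\|\sum_k A_k\|_\infty/\|\sum_k|A_k|\|_\infty$ over all $n\ge1$ and all such families). Equality is possible only when $n\ge m$, and in that case equality holds if and only if the $A_k$ are all nonzero with equal nonzero singular values, a common one-dimensional range, and pairwise orthogonal right vectors; that is, if and only if there exist $r>0$, a unit vector $u\in\mathbb C^n$, and orthonormal vectors $v_1,\ldots,v_m\in\mathbb C^n$ such that $A_k=r\,u v_k^*$ for all $1\le k\le m$.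
   Context: For $A\in\mathbb M_n(\mathbb C)$ (complex $n\times n$ matrices), $|A|=(A^*A)^{1/2}$, and $\|\cdot\|_\infty$ denotes the operator norm (largest singular value). A right vector of a rank-one matrix $A=r\,uv^*$ (with $r>0$ and $u,v$ unit vectors) is $v$. *)

theory Defs
  imports
    "Jordan_Normal_Form.DL_Rank"
    "Jordan_Normal_Form.Schur_Decomposition"
begin

definition vec_norm2 :: "complex vec \<Rightarrow> real" where
  "vec_norm2 v = sqrt (Re (v \<bullet>c v))"

(* Only meaningful for dim_col A > 0; otherwise the set is empty. *)
definition op_norm :: "complex mat \<Rightarrow> real" where
  "op_norm A = Sup {vec_norm2 (A *\<^sub>v x) | x. x \<in> carrier_vec (dim_col A) \<and> vec_norm2 x = 1}"

definition psd_mat :: "nat \<Rightarrow> complex mat \<Rightarrow> bool" where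
  "psd_mat n B \<longleftrightarrow> B \<in> carrier_mat n n \<and> mat_adjoint B = B \<and>
     (\<forall>x \<in> carrier_vec n. 0 \<le> Re ((B *\<^sub>v x) \<bullet>c x))"

(* (A^* A)^(1/2), the square root being the unique positive semidefinite one. *)
definition mat_abs :: "complex mat \<Rightarrow> complex mat" where
  "mat_abs A = (THE B. psd_mat (dim_col A) B \<and> B * B = mat_adjoint A * A)"

definition singular_values :: "complex mat \<Rightarrow> real set" where
  "singular_values A = {s. 0 \<le> s \<and> eigenvalue (mat_adjoint A * A) (complex_of_real (s\<^sup>2))}"

(* u v^* *)
definition outer_prod :: "complex vec \<Rightarrow> complex vec \<Rightarrow> complex mat" where
  "outer_prod u v = mat (dim_vec u) (dim_vec v) (\<lambda>(i, j). u $ i * cnj (v $ j))"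

(* A right vector is determined only up to a factor of modulus 1, hence a predicate. *)
definition right_vector :: "complex mat \<Rightarrow> complex vec \<Rightarrow> bool" where
  "right_vector A v \<longleftrightarrow> vec_norm2 v = 1 \<and>
     (\<exists>r > 0. \<exists>u. vec_norm2 u = 1 \<and> A = complex_of_real r \<cdot>\<^sub>m outer_prod u v)"

definition mat_range :: "complex mat \<Rightarrow> complex vec set" where
  "mat_range A = (\<lambda>x. A *\<^sub>v x) ` carrier_vec (dim_col A)"

definition subspace_dim :: "nat \<Rightarrow> complex vec set \<Rightarrow> nat" where
  "subspace_dim n W = vectorspace.dim class_ring ((module_vec TYPE(complex) n)\<lparr>carrier := W\<rparr>)"

definition mat_family_sum :: "nat \<Rightarrow> nat \<Rightarrow> (nat \<Rightarrow> complex mat) \<Rightarrow> complex mat" where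
  "mat_family_sum n m A = mat n n (\<lambda>ij. \<Sum>k = 1..m. A k $$ ij)"

definition rank_le_one_family :: "nat \<Rightarrow> nat \<Rightarrow> (nat \<Rightarrow> complex mat) \<Rightarrow> bool" where
  "rank_le_one_family n m A \<longleftrightarrow>
     (\<forall>k \<in> {1..m}. A k \<in> carrier_mat n n \<and> vec_space.rank n (A k) \<le> 1) \<and>
     (\<exists>k \<in> {1..m}. A k \<noteq> 0\<^sub>m n n)"

abbreviation norm_of_sum :: "nat \<Rightarrow> nat \<Rightarrow> (nat \<Rightarrow> complex mat) \<Rightarrow> real" where
  "norm_of_sum n m A \<equiv> op_norm (mat_family_sum n m A)"

abbreviation norm_of_abs_sum :: "nat \<Rightarrow> nat \<Rightarrow> (nat \<Rightarrow> complex mat) \<Rightarrow> real" where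
  "norm_of_abs_sum n m A \<equiv> op_norm (mat_family_sum n m (\<lambda>k. mat_abs (A k)))"

abbreviation norm_ratios :: "nat \<Rightarrow> real set" where
  "norm_ratios m \<equiv>
     {norm_of_sum n m A / norm_of_abs_sum n m A | n A. 1 \<le> n \<and> rank_le_one_family n m A}"

end

theory Submission
  imports Defs "HOL-Analysis.L2_Norm"
begin

text \<open>Write \<open>A\<^sub>k = r\<^sub>k u\<^sub>k v\<^sub>k\<^sup>*\<close> with \<open>r\<^sub>k \<ge> 0\<close> and unit vectors \<open>u\<^sub>k\<close>, \<open>v\<^sub>k\<close>; then
  \<open>|A\<^sub>k| = r\<^sub>k v\<^sub>k v\<^sub>k\<^sup>*\<close>. Let \<open>S\<close> be the sum of the \<open>A\<^sub>k\<close>, \<open>P\<close> the sum of the \<open>|A\<^sub>k|\<close> and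
  \<open>M\<close> the norm of \<open>P\<close>. For a unit vector \<open>x\<close> put \<open>d\<^sub>k = \<langle>x, v\<^sub>k\<rangle>\<close>, so that
  \<open>S x = \<Sum>\<^sub>k r\<^sub>k d\<^sub>k u\<^sub>k\<close>. Everything rests on one estimate, a Schur test for the Gram matrix of the
  \<open>u\<^sub>k\<close> weighted by the \<open>r\<^sub>k\<close> (lemma \<open>weighted_Schur_test\<close>): if
  \<open>\<Sum>\<^sub>k r\<^sub>k |\<langle>u\<^sub>j, u\<^sub>k\<rangle>| \<le> G\<close> for every \<open>j\<close>, then
  \<open>\<parallel>S x\<parallel>\<^sup>2 \<le> G \<cdot> \<Sum>\<^sub>k r\<^sub>k |d\<^sub>k|\<^sup>2 = G \<cdot> \<langle>P x, x\<rangle> \<le> G M\<close>.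

  Evaluating the quadratic form of \<open>P\<close> at \<open>v\<^sub>j\<close> gives \<open>r\<^sub>j \<le> M\<close>, and \<open>|\<langle>u\<^sub>j, u\<^sub>k\<rangle>| \<le> 1\<close>, so
  \<open>G = m M\<close> is admissible. This is the inequality.

  In the case of equality the largest weighted row sum must itself be \<open>m M\<close>, since a smaller \<open>G\<close> would
  give a smaller bound on the norm. So some row \<open>j\<close> has all \<open>r\<^sub>k = M\<close> and all
  \<open>|\<langle>u\<^sub>j, u\<^sub>k\<rangle>| = 1\<close>: the left vectors agree up to phases, which can be moved to the right
  vectors. The quadratic form of \<open>P\<close> at \<open>v\<^sub>i\<close> now equals \<open>M \<Sum>\<^sub>k |\<langle>v\<^sub>i, v\<^sub>k\<rangle>|\<^sup>2 \<le> M\<close>,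
  and its \<open>i\<close>-th term alone is \<open>M\<close>, so the \<open>v\<^sub>k\<close> are orthonormal; in particular \<open>m \<le> n\<close>.

  Conversely, let \<open>A\<^sub>k = r u v\<^sub>k\<^sup>*\<close> with orthonormal \<open>v\<^sub>k\<close>. Bessel's inequality gives \<open>M \<le> r\<close>,
  while \<open>S\<close> maps the unit vector \<open>m\<^sup>-\<^sup>1\<^sup>/\<^sup>2 \<Sum>\<^sub>k v\<^sub>k\<close> to a vector of norm \<open>r \<surd>m\<close>. For \<open>n = m\<close>
  the matrix units of the first row are such a family, so the constant is sharp.\<close>

section \<open>The Hermitian inner product on complex column vectors\<close>

lemma cscalar_prod_eq_sum:
  "y \<in> carrier_vec n \<Longrightarrow> x \<bullet>c y = (\<Sum>i<n. x $ i * cnj (y $ i))"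
  by (auto simp: scalar_prod_def conjugate_complex_def atLeast0LessThan intro!: sum.cong)

text \<open>The form is linear in its first argument and conjugate-linear in its second.\<close>

lemma cscalar_prod_commute:
  assumes "x \<in> carrier_vec n" "y \<in> carrier_vec n"
  shows "y \<bullet>c x = cnj (x \<bullet>c y)"
  using assms by (simp add: cscalar_prod_eq_sum mult.commute)

lemma cscalar_prod_smult_left:
  fixes x y :: "complex vec"
  assumes "x \<in> carrier_vec n" "y \<in> carrier_vec n"
  shows "(c \<cdot>\<^sub>v x) \<bullet>c y = c * (x \<bullet>c y)"
  using assms by (simp add: cscalar_prod_eq_sum sum_distrib_left mult.assoc)

lemma cscalar_prod_smult_right:
  assumes "x \<in> carrier_vec n" "y \<in> carrier_vec n"
  shows "x \<bullet>c (c \<cdot>\<^sub>v y) = cnj c * (x \<bullet>c y)"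
  using assms by (simp add: cscalar_prod_eq_sum[of _ n] sum_distrib_left mult_ac)

lemma cscalar_prod_minus_left:
  fixes x y z :: "complex vec"
  assumes "x \<in> carrier_vec n" "y \<in> carrier_vec n" "z \<in> carrier_vec n"
  shows "(x - y) \<bullet>c z = x \<bullet>c z - y \<bullet>c z"
  using assms by (simp add: cscalar_prod_eq_sum sum_subtractf left_diff_distrib)

lemma vec_norm2_eq_L2_set:
  "x \<in> carrier_vec n \<Longrightarrow> vec_norm2 x = L2_set (\<lambda>i. cmod (x $ i)) {..<n}"
  by (simp add: vec_norm2_def cscalar_prod_eq_sum L2_set_def complex_norm_square[symmetric]
      del: of_real_power)

lemma vec_norm2_nonneg: "0 \<le> vec_norm2 x"
  by (simp add: vec_norm2_eq_L2_set[of x "dim_vec x"] L2_set_nonneg)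

lemma cscalar_prod_self: "x \<bullet>c x = complex_of_real ((vec_norm2 x)\<^sup>2)"
  by (simp add: vec_norm2_eq_L2_set[of x "dim_vec x"] cscalar_prod_eq_sum[of x "dim_vec x"]
      L2_set_def sum_nonneg complex_norm_square[symmetric])

lemma vec_norm2_smult: "vec_norm2 (c \<cdot>\<^sub>v x) = cmod c * vec_norm2 x"
proof -
  have "vec_norm2 (c \<cdot>\<^sub>v x) = L2_set (\<lambda>i. cmod c * cmod (x $ i)) {..<dim_vec x}"
    by (auto simp: vec_norm2_eq_L2_set[of _ "dim_vec x"] norm_mult intro!: L2_set_cong)
  then show ?thesis
    by (simp add: vec_norm2_eq_L2_set[of x "dim_vec x"] L2_set_right_distrib)
qed

lemma vec_norm2_unit_vec: "i < n \<Longrightarrow> vec_norm2 (unit_vec n i) = 1"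
  by (simp add: vec_norm2_def scalar_prod_left_unit conjugate_complex_def)

lemma vec_norm2_eq_0_iff:
  "x \<in> carrier_vec n \<Longrightarrow> vec_norm2 x = 0 \<longleftrightarrow> x = 0\<^sub>v n"
  using conjugate_square_eq_0_vec[of x n] by (simp add: cscalar_prod_self)

lemma Cauchy_Schwarz_vec:
  assumes "x \<in> carrier_vec n" "y \<in> carrier_vec n"
  shows "cmod (x \<bullet>c y) \<le> vec_norm2 x * vec_norm2 y"
proof -
  have "cmod (x \<bullet>c y) \<le> (\<Sum>i<n. \<bar>cmod (x $ i)\<bar> * \<bar>cmod (y $ i)\<bar>)"
    unfolding cscalar_prod_eq_sum[OF assms(2)] by (rule sum_norm_le) (simp add: norm_mult)
  also have "\<dots> \<le> vec_norm2 x * vec_norm2 y"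
    unfolding vec_norm2_eq_L2_set[OF assms(1)] vec_norm2_eq_L2_set[OF assms(2)]
    by (rule L2_set_mult_ineq)
  finally show ?thesis .
qed

text \<open>The equality case of the Cauchy-Schwarz inequality for unit vectors.\<close>

lemma unit_vec_parallel:
  assumes x: "x \<in> carrier_vec n" and y: "y \<in> carrier_vec n"
    and nx: "vec_norm2 x = 1" and ny: "vec_norm2 y = 1" and eq: "cmod (x \<bullet>c y) = 1"
  shows "x = (x \<bullet>c y) \<cdot>\<^sub>v y"
proof -
  define c where "c = x \<bullet>c y"
  have cy: "c \<cdot>\<^sub>v y \<in> carrier_vec n" and d: "x - c \<cdot>\<^sub>v y \<in> carrier_vec n" using x y by auto
  have cc: "c * cnj c = 1" using eq by (simp add: c_def complex_norm_square[symmetric])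
  have yy: "y \<bullet>c y = 1" and xx: "x \<bullet>c x = 1" using nx ny by (simp_all add: cscalar_prod_self)
  have yx: "y \<bullet>c x = cnj c" unfolding c_def by (rule cscalar_prod_commute[OF x y])
  \<comment> \<open>The residual of projecting \<open>x\<close> onto \<open>y\<close> is orthogonal to \<open>y\<close>; since \<open>|c| = 1\<close>, it is
      orthogonal to \<open>x\<close> as well, hence to itself.\<close>
  have 1: "(x - c \<cdot>\<^sub>v y) \<bullet>c x = 0" 
    using x y cc by (simp add: cscalar_prod_minus_left[of _ n] cscalar_prod_smult_left[of _ n] xx yx)
  have 2: "(x - c \<cdot>\<^sub>v y) \<bullet>c y = 0"
    using x y by (simp add: cscalar_prod_minus_left[of _ n] cscalar_prod_smult_left[of _ n] yy c_def)
  have "(x - c \<cdot>\<^sub>v y) \<bullet>c (x - c \<cdot>\<^sub>v y)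
      = cnj (x \<bullet>c (x - c \<cdot>\<^sub>v y) - c * (y \<bullet>c (x - c \<cdot>\<^sub>v y))) "
    using x y d cy
    by (subst cscalar_prod_commute[OF d d])
       (simp add: cscalar_prod_minus_left[of _ n] cscalar_prod_smult_left[of _ n])
  also have "\<dots> = 0"
    using 1 2 cscalar_prod_commute[OF d x] cscalar_prod_commute[OF d y] by simp
  finally have "x - c \<cdot>\<^sub>v y = 0\<^sub>v n" using conjugate_square_eq_0_vec[OF d] by simp
  then have "\<forall>i<n. (x - c \<cdot>\<^sub>v y) $ i = 0" by simp
  then have "x = c \<cdot>\<^sub>v y" using x y by (intro eq_vecI) auto
  then show ?thesis by (simp add: c_def)
qed

section \<open>Finite linear combinations and the weighted Schur test\<close>

text \<open>Indexed by numbers rather than by a set of vectors, because the left vectors of a family of dyads may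
  coincide.\<close>

definition lincomb_vec :: "nat \<Rightarrow> nat set \<Rightarrow> (nat \<Rightarrow> complex) \<Rightarrow> (nat \<Rightarrow> complex vec) \<Rightarrow> complex vec"
  where "lincomb_vec n K c u = vec n (\<lambda>i. \<Sum>k\<in>K. c k * u k $ i)"

lemma lincomb_vec_carrier [simp]: "lincomb_vec n K c u \<in> carrier_vec n"
  by (simp add: lincomb_vec_def)

lemma lincomb_vec_cscalar_prod:
  assumes "y \<in> carrier_vec n"
  shows "lincomb_vec n K c u \<bullet>c y = (\<Sum>k\<in>K. c k * (u k \<bullet>c y))"
  by (simp add: cscalar_prod_eq_sum[OF assms] lincomb_vec_def sum_distrib_left sum_distrib_right
      mult.assoc sum.swap[of _ K])

lemma cscalar_prod_lincomb_vec:
  assumes "y \<in> carrier_vec n" and "\<And>k. k \<in> K \<Longrightarrow> u k \<in> carrier_vec n"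
  shows "y \<bullet>c lincomb_vec n K c u = (\<Sum>k\<in>K. cnj (c k) * (y \<bullet>c u k))"
proof -
  have "y \<bullet>c lincomb_vec n K c u = cnj (\<Sum>k\<in>K. c k * (u k \<bullet>c y))"
    by (simp only: cscalar_prod_commute[OF lincomb_vec_carrier assms(1)]
        lincomb_vec_cscalar_prod[OF assms(1)])
  also have "\<dots> = (\<Sum>k\<in>K. cnj (c k) * cnj (u k \<bullet>c y))" by simp
  also have "\<dots> = (\<Sum>k\<in>K. cnj (c k) * (y \<bullet>c u k))"
    using cscalar_prod_commute[OF assms(2) assms(1)] by (auto intro!: sum.cong)
  finally show ?thesis .
qed

lemma lincomb_vec_cscalar_prod_lincomb_vec:
  assumes "\<And>k. k \<in> L \<Longrightarrow> v k \<in> carrier_vec n" and "\<And>k. k \<in> K \<Longrightarrow> u k \<in> carrier_vec n"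
  shows "lincomb_vec n K c u \<bullet>c lincomb_vec n L d v
    = (\<Sum>j\<in>K. \<Sum>k\<in>L. c j * (cnj (d k) * (u j \<bullet>c v k)))"
  unfolding lincomb_vec_cscalar_prod[OF lincomb_vec_carrier]
  using assms by (auto simp: cscalar_prod_lincomb_vec sum_distrib_left intro!: sum.cong)

text \<open>Expand the squared norm into a double sum over the Gram matrix and split each product by
  \<open>2 |d\<^sub>j| |d\<^sub>k| \<le> |d\<^sub>j|\<^sup>2 + |d\<^sub>k|\<^sup>2\<close>. By symmetry of the weights \<open>r\<^sub>j r\<^sub>k |\<langle>u\<^sub>j, u\<^sub>k\<rangle>|\<close> the two halves
  agree, and each row sum is at most \<open>G\<close>. Keeping the weights \<open>r\<^sub>k\<close> on both sides is what later makes
  the right-hand side a quadratic form of the sum of absolute values.\<close>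

lemma weighted_Schur_test:
  fixes r :: "nat \<Rightarrow> real" and d :: "nat \<Rightarrow> complex"
  assumes r: "\<And>k. k \<in> K \<Longrightarrow> 0 \<le> r k"
    and u: "\<And>k. k \<in> K \<Longrightarrow> u k \<in> carrier_vec n"
    and G: "\<And>j. j \<in> K \<Longrightarrow> (\<Sum>k\<in>K. r k * cmod (u j \<bullet>c u k)) \<le> G"
  shows "(vec_norm2 (lincomb_vec n K (\<lambda>k. r k * d k) u))\<^sup>2 \<le> G * (\<Sum>k\<in>K. r k * (cmod (d k))\<^sup>2)"
proof -
  let ?g = "\<lambda>j k. cmod (u j \<bullet>c u k)" and ?a = "\<lambda>k. cmod (d k)"
  let ?y = "lincomb_vec n K (\<lambda>k. complex_of_real (r k) * d k) u"
  have g_sym: "?g j k = ?g k j" if "j \<in> K" "k \<in> K" for j k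
    using cscalar_prod_commute[OF u u, OF that] by simp
  have "?y \<bullet>c ?y
      = (\<Sum>j\<in>K. \<Sum>k\<in>K. (r j * d j) * (cnj (r k * d k) * (u j \<bullet>c u k)))"
    by (simp only: lincomb_vec_cscalar_prod_lincomb_vec u)
  then have "cmod (?y \<bullet>c ?y)
      \<le> (\<Sum>j\<in>K. \<Sum>k\<in>K. (r j * ?a j) * (r k * ?a k * ?g j k))"
    by (auto simp: norm_mult r intro!: sum_norm_le)
  also have "\<dots> \<le> (\<Sum>j\<in>K. \<Sum>k\<in>K. (r j * r k * ?g j k * (?a j)\<^sup>2 + r j * r k * ?g j k * (?a k)\<^sup>2) / 2)"
  proof (intro sum_mono)
    fix j k assume jk: "j \<in> K" "k \<in> K"
    have "(r j * r k * ?g j k) * (2 * ?a j * ?a k) \<le> (r j * r k * ?g j k) * ((?a j)\<^sup>2 + (?a k)\<^sup>2)"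
      by (rule mult_left_mono) (use r jk in \<open>auto intro: sum_squares_bound\<close>)
    then show "(r j * ?a j) * (r k * ?a k * ?g j k)
        \<le> (r j * r k * ?g j k * (?a j)\<^sup>2 + r j * r k * ?g j k * (?a k)\<^sup>2) / 2"
      by (simp add: algebra_simps)
  qed
  also have "\<dots> = ((\<Sum>j\<in>K. \<Sum>k\<in>K. r j * r k * ?g j k * (?a j)\<^sup>2)
      + (\<Sum>j\<in>K. \<Sum>k\<in>K. r j * r k * ?g j k * (?a k)\<^sup>2)) / 2"
    by (simp add: sum.distrib sum_divide_distrib[symmetric])
  also have "(\<Sum>j\<in>K. \<Sum>k\<in>K. r j * r k * ?g j k * (?a k)\<^sup>2)
      = (\<Sum>j\<in>K. \<Sum>k\<in>K. r j * r k * ?g j k * (?a j)\<^sup>2)"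
    by (subst sum.swap) (auto simp: g_sym mult_ac intro!: sum.cong)
  also have "((\<Sum>j\<in>K. \<Sum>k\<in>K. r j * r k * ?g j k * (?a j)\<^sup>2)
      + (\<Sum>j\<in>K. \<Sum>k\<in>K. r j * r k * ?g j k * (?a j)\<^sup>2)) / 2
      = (\<Sum>j\<in>K. r j * (?a j)\<^sup>2 * (\<Sum>k\<in>K. r k * ?g j k))"
    by (simp add: sum_distrib_left mult_ac)
  also have "\<dots> \<le> (\<Sum>j\<in>K. r j * (?a j)\<^sup>2 * G)"
    by (intro sum_mono mult_left_mono G) (auto simp: r)
  also have "\<dots> = G * (\<Sum>k\<in>K. r k * (?a k)\<^sup>2)"
    by (simp only: sum_distrib_right[symmetric] mult.commute[of G])
  finally show ?thesis by (simp add: cscalar_prod_self norm_power)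
qed

text \<open>For the projection \<open>y\<close> of \<open>x\<close> both \<open>\<langle>x, y\<rangle>\<close> and \<open>\<parallel>y\<parallel>\<^sup>2\<close> are the sum in question, so the
  Cauchy-Schwarz inequality gives \<open>\<parallel>y\<parallel> \<le> \<parallel>x\<parallel>\<close>.\<close>

lemma Bessel_inequality:
  fixes v :: "nat \<Rightarrow> complex vec"
  assumes "finite K" and v: "\<And>k. k \<in> K \<Longrightarrow> v k \<in> carrier_vec n"
    and orth: "\<And>j k. j \<in> K \<Longrightarrow> k \<in> K \<Longrightarrow> v j \<bullet>c v k = (if j = k then 1 else 0)"
    and x: "x \<in> carrier_vec n"
  shows "(\<Sum>k\<in>K. (cmod (x \<bullet>c v k))\<^sup>2) \<le> (vec_norm2 x)\<^sup>2"
proof -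
  let ?T = "\<Sum>k\<in>K. (cmod (x \<bullet>c v k))\<^sup>2"
  let ?y = "lincomb_vec n K (\<lambda>k. x \<bullet>c v k) v"
  have T0: "0 \<le> ?T" by (simp add: sum_nonneg)
  have "?y \<bullet>c ?y = (\<Sum>k\<in>K. \<Sum>j\<in>K. (x \<bullet>c v k) * (cnj (x \<bullet>c v j) * (v k \<bullet>c v j)))"
    by (simp only: lincomb_vec_cscalar_prod_lincomb_vec v)
  also have "\<dots> = (\<Sum>k\<in>K. \<Sum>j\<in>K. if k = j then (x \<bullet>c v k) * cnj (x \<bullet>c v k) else 0)"
    by (intro sum.cong refl) (simp add: orth)
  also have "\<dots> = complex_of_real ?T"
    using \<open>finite K\<close> by (simp add: complex_norm_square del: of_real_power)
  finally have ny: "(vec_norm2 ?y)\<^sup>2 = ?T" unfolding cscalar_prod_self of_real_eq_iff .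
  have "x \<bullet>c ?y = complex_of_real ?T"
    by (simp add: cscalar_prod_lincomb_vec x v complex_norm_square mult.commute del: of_real_power)
  then have "?T = cmod (x \<bullet>c ?y)" using T0 by (simp only: norm_of_real abs_of_nonneg)
  also have "\<dots> \<le> vec_norm2 x * vec_norm2 ?y" by (rule Cauchy_Schwarz_vec) (use x in auto)
  finally have le: "?T \<le> vec_norm2 x * vec_norm2 ?y" .
  then have "(vec_norm2 ?y)\<^sup>2 \<le> vec_norm2 x * vec_norm2 ?y" using ny by simp
  then have "vec_norm2 ?y \<le> vec_norm2 x"
    using vec_norm2_nonneg[of ?y] vec_norm2_nonneg[of x]
    by (cases "vec_norm2 ?y = 0") (auto simp: power2_eq_square)
  then have "(vec_norm2 ?y)\<^sup>2 \<le> (vec_norm2 x)\<^sup>2"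
    by (rule power_mono[OF _ vec_norm2_nonneg])
  then show ?thesis using ny by simp
qed

text \<open>Sum Bessel's inequality over the standard basis: the squared moduli of all coordinates add up to the
  number of vectors on one side and to at most the dimension on the other.\<close>

lemma orthonormal_family_card_le:
  fixes v :: "nat \<Rightarrow> complex vec"
  assumes "finite K" and v: "\<And>k. k \<in> K \<Longrightarrow> v k \<in> carrier_vec n"
    and orth: "\<And>j k. j \<in> K \<Longrightarrow> k \<in> K \<Longrightarrow> v j \<bullet>c v k = (if j = k then 1 else 0)"
  shows "card K \<le> n"
proof -
  have coord: "cmod (unit_vec n i \<bullet>c v k) = cmod (v k $ i)" if "i < n" "k \<in> K" for i k
    using that v[OF that(2)] by (simp add: scalar_prod_left_unit conjugate_complex_def)
  have "real (card K) = (\<Sum>k\<in>K. (vec_norm2 (v k))\<^sup>2)"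
    using orth by (simp add: vec_norm2_def)
  also have "\<dots> = (\<Sum>k\<in>K. \<Sum>i<n. (cmod (v k $ i))\<^sup>2)"
    by (intro sum.cong) (auto simp: vec_norm2_eq_L2_set[OF v] L2_set_def sum_nonneg)
  also have "\<dots> = (\<Sum>i<n. \<Sum>k\<in>K. (cmod (unit_vec n i \<bullet>c v k))\<^sup>2)"
    by (subst sum.swap) (auto simp: coord intro!: sum.cong)
  also have "\<dots> \<le> (\<Sum>i<n. (vec_norm2 (unit_vec n i :: complex vec))\<^sup>2)"
    by (intro sum_mono Bessel_inequality[OF assms(1), of v n] v orth) auto
  also have "\<dots> = real n" by (simp add: vec_norm2_unit_vec)
  finally show ?thesis by simp
qed


section \<open>The operator norm\<close>

text \<open>A crude bound by the Frobenius norm. Its purpose is to make the set in the definition of the operator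
  norm bounded, so that its supremum dominates its elements.\<close>

lemma vec_norm2_mult_mat_vec_le:
  assumes A: "A \<in> carrier_mat n n" and x: "x \<in> carrier_vec n" "vec_norm2 x = 1"
  shows "vec_norm2 (A *\<^sub>v x) \<le> L2_set (\<lambda>i. vec_norm2 (conjugate (row A i))) {..<n}"
proof -
  have Ax: "A *\<^sub>v x \<in> carrier_vec n" using A x by auto
  have "cmod ((A *\<^sub>v x) $ i) \<le> vec_norm2 (conjugate (row A i))" if "i < n" for i
  proof -
    have row: "row A i \<in> carrier_vec n" using A by auto
    have "(A *\<^sub>v x) $ i = x \<bullet>c conjugate (row A i)"
      using that A x row by (simp add: comm_scalar_prod[OF x(1) row])
    then show ?thesis
      using Cauchy_Schwarz_vec[OF x(1) carrier_vec_conjugate[OF row]] x(2) by simp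
  qed
  then show ?thesis
    unfolding vec_norm2_eq_L2_set[OF Ax] by (intro L2_set_mono) auto
qed

lemma vec_norm2_le_op_norm:
  assumes "A \<in> carrier_mat n n" and "x \<in> carrier_vec n" "vec_norm2 x = 1"
  shows "vec_norm2 (A *\<^sub>v x) \<le> op_norm A"
  unfolding op_norm_def
  using assms vec_norm2_mult_mat_vec_le[OF assms(1)]
  by (intro cSup_upper) (auto intro!: bdd_aboveI)

text \<open>In dimension zero the supremum would run over the empty set, hence \<open>0 < n\<close>.\<close>

lemma op_norm_le:
  assumes "A \<in> carrier_mat n n" and "0 < n"
    and "\<And>x. x \<in> carrier_vec n \<Longrightarrow> vec_norm2 x = 1 \<Longrightarrow> vec_norm2 (A *\<^sub>v x) \<le> C"
  shows "op_norm A \<le> C"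
  unfolding op_norm_def
  using assms vec_norm2_unit_vec[OF assms(2)] unit_vec_carrier[of n 0]
  by (intro cSup_least) blast+

section \<open>Dyads\<close>

abbreviation dyad :: "real \<Rightarrow> complex vec \<Rightarrow> complex vec \<Rightarrow> complex mat"
  where "dyad r u v \<equiv> complex_of_real r \<cdot>\<^sub>m outer_prod u v"

lemma outer_prod_carrier:
  "u \<in> carrier_vec n \<Longrightarrow> v \<in> carrier_vec k \<Longrightarrow> outer_prod u v \<in> carrier_mat n k"
  unfolding outer_prod_def by (metis mat_carrier carrier_vecD)

lemma outer_prod_index:
  "i < dim_vec u \<Longrightarrow> j < dim_vec v \<Longrightarrow> outer_prod u v $$ (i, j) = u $ i * cnj (v $ j)"
  by (simp add: outer_prod_def)

lemma outer_prod_dim [simp]: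
  "dim_row (outer_prod u v) = dim_vec u" "dim_col (outer_prod u v) = dim_vec v"
  by (simp_all add: outer_prod_def)

lemma dyad_mult_vec:
  assumes "u \<in> carrier_vec n" "v \<in> carrier_vec n" "x \<in> carrier_vec n"
  shows "dyad r u v *\<^sub>v x = (complex_of_real r * (x \<bullet>c v)) \<cdot>\<^sub>v u"
  using assms
  by (intro eq_vecI)
     (auto simp: scalar_prod_def outer_prod_index sum_distrib_left sum_distrib_right
        conjugate_complex_def mult_ac intro!: sum.cong)

lemma mat_adjoint_index:
  "i < dim_col A \<Longrightarrow> j < dim_row A \<Longrightarrow> mat_adjoint A $$ (i, j) = cnj (A $$ (j, i))"
  by (simp add: mat_adjoint_def mat_of_rows_def conjugate_complex_def)

lemma mat_adjoint_dim [simp]: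
  "dim_row (mat_adjoint A) = dim_col A" "dim_col (mat_adjoint A) = dim_row A"
  by (simp_all add: mat_adjoint_def)

lemma cscalar_prod_mat_adjoint:
  fixes A :: "complex mat"
  assumes "A \<in> carrier_mat n n" "x \<in> carrier_vec n" "y \<in> carrier_vec n"
  shows "(A *\<^sub>v x) \<bullet>c y = x \<bullet>c (mat_adjoint A *\<^sub>v y)"
proof -
  have "(A *\<^sub>v x) \<bullet>c y = (\<Sum>i<n. \<Sum>j<n. A $$ (i, j) * x $ j * cnj (y $ i))"
    using assms by (auto simp: cscalar_prod_eq_sum[of _ n] scalar_prod_def sum_distrib_right
        atLeast0LessThan intro!: sum.cong)
  also have "\<dots> = (\<Sum>j<n. \<Sum>i<n. A $$ (i, j) * x $ j * cnj (y $ i))"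
    by (rule sum.swap)
  also have "\<dots> = x \<bullet>c (mat_adjoint A *\<^sub>v y)"
  proof -
    have "mat_adjoint A *\<^sub>v y \<in> carrier_vec n" using assms by (intro carrier_vecI) simp
    then show ?thesis
      using assms by (auto simp: cscalar_prod_eq_sum[of _ n] scalar_prod_def sum_distrib_left
          mat_adjoint_index atLeast0LessThan mult_ac intro!: sum.cong)
  qed
  finally show ?thesis .
qed

lemma mat_adjoint_dyad_mult_dyad:
  assumes u: "u \<in> carrier_vec n" "vec_norm2 u = 1" and v: "v \<in> carrier_vec n"
  shows "mat_adjoint (dyad r u v) * dyad r u v = dyad (r\<^sup>2) v v"
proof (rule eq_matI)
  fix a b assume "a < dim_row (dyad (r\<^sup>2) v v)" "b < dim_col (dyad (r\<^sup>2) v v)"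
  then have ab: "a < n" "b < n" using v by auto
  have uu: "(\<Sum>i<n. u $ i * cnj (u $ i)) = 1"
    using cscalar_prod_self[of u] u by (simp add: cscalar_prod_eq_sum[of _ n])
  have "(mat_adjoint (dyad r u v) * dyad r u v) $$ (a, b)
      = (\<Sum>i<n. (complex_of_real r)\<^sup>2 * (v $ a * cnj (v $ b)) * (u $ i * cnj (u $ i)))"
    using ab u v
    by (auto simp: scalar_prod_def mat_adjoint_index outer_prod_index atLeast0LessThan
        power2_eq_square mult_ac intro!: sum.cong)
  also have "\<dots> = dyad (r\<^sup>2) v v $$ (a, b)"
    using ab v uu by (simp add: sum_distrib_left[symmetric] outer_prod_index)
  finally show "(mat_adjoint (dyad r u v) * dyad r u v) $$ (a, b) = dyad (r\<^sup>2) v v $$ (a, b)" .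
qed (use u v in auto)

lemma mat_eqI_mult_vec:
  fixes A B :: "complex mat"
  assumes A: "A \<in> carrier_mat n n" and B: "B \<in> carrier_mat n n"
    and eq: "\<And>x. x \<in> carrier_vec n \<Longrightarrow> A *\<^sub>v x = B *\<^sub>v x"
  shows "A = B"
proof (rule eq_matI)
  fix i j assume "i < dim_row B" "j < dim_col B"
  then have ij: "i < n" "j < n" using B by auto
  have "(A *\<^sub>v unit_vec n j) $ i = (B *\<^sub>v unit_vec n j) $ i" using eq by simp
  then show "A $$ (i, j) = B $$ (i, j)" using ij A B by (simp add: scalar_prod_right_unit)
qed (use A B in auto)

lemma psd_mat_dyad:
  assumes "0 \<le> r" and v: "v \<in> carrier_vec n"
  shows "psd_mat n (dyad r v v)"
  unfolding psd_mat_def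
proof (intro conjI ballI)
  show "dyad r v v \<in> carrier_mat n n" using v by (simp add: outer_prod_carrier)
  show "mat_adjoint (dyad r v v) = dyad r v v"
    by (rule eq_matI) (use v in \<open>auto simp: mat_adjoint_index outer_prod_index\<close>)
  fix x :: "complex vec" assume x: "x \<in> carrier_vec n"
  have "(dyad r v v *\<^sub>v x) \<bullet>c x = complex_of_real r * ((x \<bullet>c v) * cnj (x \<bullet>c v))"
    using x v by (simp add: dyad_mult_vec cscalar_prod_smult_left[of _ n] 
        cscalar_prod_commute[OF x v] mult.assoc)
  also have "\<dots> = complex_of_real (r * (cmod (x \<bullet>c v))\<^sup>2)"
    by (simp add: complex_norm_square[symmetric])
  finally show "0 \<le> Re ((dyad r v v *\<^sub>v x) \<bullet>c x)" using \<open>0 \<le> r\<close> by simp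
qed

text \<open>A direct argument for this square. On the orthogonal complement of \<open>v\<close> we have
  \<open>\<parallel>B x\<parallel>\<^sup>2 = \<langle>x, B\<^sup>2 x\<rangle> = 0\<close>, so \<open>B\<close> vanishes there. As \<open>B\<close> is Hermitian, \<open>B v\<close> is then orthogonal
  to that complement, so \<open>B v = l v\<close>; here \<open>l\<close> is real and nonnegative with \<open>l\<^sup>2 = r\<^sup>2\<close>.\<close>

lemma psd_sqrt_dyad_unique:
  assumes r: "0 \<le> r" and v: "v \<in> carrier_vec n" "vec_norm2 v = 1"
    and psd: "psd_mat n B" and sq: "B * B = dyad (r\<^sup>2) v v"
  shows "B = dyad r v v"
proof -
  have B: "B \<in> carrier_mat n n" and adj: "mat_adjoint B = B"
    and pos: "\<And>x. x \<in> carrier_vec n \<Longrightarrow> 0 \<le> Re ((B *\<^sub>v x) \<bullet>c x)"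
    using psd by (auto simp: psd_mat_def)
  have Bx: "B *\<^sub>v x \<in> carrier_vec n" if "x \<in> carrier_vec n" for x using B that by auto
  have vv: "v \<bullet>c v = 1" using v by (simp add: cscalar_prod_self)
  have herm: "(B *\<^sub>v x) \<bullet>c y = x \<bullet>c (B *\<^sub>v y)" if "x \<in> carrier_vec n" "y \<in> carrier_vec n" for x y
    using cscalar_prod_mat_adjoint[OF B that] adj by simp
  have BB: "B *\<^sub>v (B *\<^sub>v x) = (complex_of_real (r\<^sup>2) * (x \<bullet>c v)) \<cdot>\<^sub>v v" if "x \<in> carrier_vec n" for x
    using assoc_mult_mat_vec[OF B B that] dyad_mult_vec[OF v(1) v(1) that] by (simp only: sq)
  have kernel: "B *\<^sub>v x = 0\<^sub>v n" if x: "x \<in> carrier_vec n" and "x \<bullet>c v = 0" for x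
  proof -
    have "(B *\<^sub>v x) \<bullet>c (B *\<^sub>v x) = x \<bullet>c (0 \<cdot>\<^sub>v v)"
      using herm[OF x Bx[OF x]] BB[OF x] \<open>x \<bullet>c v = 0\<close> by simp
    also have "\<dots> = 0" using x v by (simp add: cscalar_prod_smult_right[of _ n])
    finally show ?thesis using conjugate_square_eq_0_vec[OF Bx[OF x]] by simp
  qed
  define proj where "proj x = (x \<bullet>c v) \<cdot>\<^sub>v v" for x
  have proj: "proj x \<in> carrier_vec n" for x using v by (simp add: proj_def)
  have orth: "(x - proj x) \<bullet>c v = 0" if "x \<in> carrier_vec n" for x
    using that v vv by (simp add: proj_def cscalar_prod_minus_left[of _ n] cscalar_prod_smult_left[of _ n])
  have B_proj: "B *\<^sub>v x = B *\<^sub>v proj x" if x: "x \<in> carrier_vec n" for x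
  proof -
    have "B *\<^sub>v x - B *\<^sub>v proj x = 0\<^sub>v n"
      using kernel[OF _ orth[OF x]] x proj[of x] mult_minus_distrib_mat_vec[OF B x proj[of x]] by simp
    then have "\<forall>i<n. (B *\<^sub>v x - B *\<^sub>v proj x) $ i = 0" by simp
    then show ?thesis using B x proj[of x] by (intro eq_vecI) auto
  qed
  define l where "l = (B *\<^sub>v v) \<bullet>c v"
  have Bv: "B *\<^sub>v v = l \<cdot>\<^sub>v v"
  proof -
    let ?w = "B *\<^sub>v v - proj (B *\<^sub>v v)"
    have w: "?w \<in> carrier_vec n" using Bx[OF v(1)] proj by auto
    \<comment> \<open>\<open>w\<close> is the part of \<open>B v\<close> orthogonal to \<open>v\<close>; being killed by \<open>B\<close>, it is orthogonal to \<open>B v\<close> too.\<close>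
    have wv: "v \<bullet>c ?w = 0"
      using cscalar_prod_commute[OF w v(1)] orth[OF Bx[OF v(1)]] by simp
    have Bvw: "(B *\<^sub>v v) \<bullet>c ?w = 0"
      using herm[OF v(1) w] kernel[OF w orth[OF Bx[OF v(1)]]] v by simp
    have "?w \<bullet>c ?w = (B *\<^sub>v v) \<bullet>c ?w - proj (B *\<^sub>v v) \<bullet>c ?w"
      by (rule cscalar_prod_minus_left[OF Bx[OF v(1)] proj w])
    also have "\<dots> = 0"
      using Bvw wv cscalar_prod_smult_left[OF v(1) w] by (simp add: proj_def)
    finally have "?w = 0\<^sub>v n" using conjugate_square_eq_0_vec[OF w] by simp
    then have "\<forall>i<n. ?w $ i = 0" by simp
    then show ?thesis using B v by (intro eq_vecI) (auto simp: proj_def l_def)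
  qed
  have "l = cnj l" unfolding l_def
    using cscalar_prod_commute[OF v(1) Bx[OF v(1)]] herm[OF v(1) v(1)] by simp
  then obtain t where t: "l = complex_of_real t"
    by (metis Reals_cnj_iff of_real_Re)
  have "0 \<le> t" using pos[OF v(1)] t by (simp add: l_def[symmetric])
  have "l * l = complex_of_real (r\<^sup>2)"
  proof -
    have "(l * l) \<cdot>\<^sub>v v = complex_of_real (r\<^sup>2) \<cdot>\<^sub>v v"
      using BB[OF v(1)] vv mult_mat_vec[OF B v(1)] by (simp add: Bv smult_smult_assoc)
    then have "((l * l) \<cdot>\<^sub>v v) \<bullet>c v = (complex_of_real (r\<^sup>2) \<cdot>\<^sub>v v) \<bullet>c v" by simp
    then show ?thesis using v vv by (simp add: cscalar_prod_smult_left[of _ n])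
  qed
  then have "t\<^sup>2 = r\<^sup>2" unfolding t by (simp only: power2_eq_square of_real_mult[symmetric] of_real_eq_iff)
  then have "t = r" using \<open>0 \<le> t\<close> r by simp
  show ?thesis
  proof (rule mat_eqI_mult_vec[OF B])
    show "dyad r v v \<in> carrier_mat n n" using v by (simp add: outer_prod_carrier)
    fix x :: "complex vec" assume x: "x \<in> carrier_vec n"
    have "B *\<^sub>v x = (x \<bullet>c v) \<cdot>\<^sub>v (B *\<^sub>v v)"
      using B_proj[OF x] mult_mat_vec[OF B v(1)] by (simp add: proj_def)
    then show "B *\<^sub>v x = dyad r v v *\<^sub>v x"
      using x v by (simp add: dyad_mult_vec Bv t \<open>t = r\<close> smult_smult_assoc mult.commute)
  qed
qed

lemma mat_abs_dyad:
  assumes "0 \<le> r" and u: "u \<in> carrier_vec n" "vec_norm2 u = 1"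
    and v: "v \<in> carrier_vec n" "vec_norm2 v = 1"
  shows "mat_abs (dyad r u v) = dyad r v v"
proof -
  have dim: "dim_col (dyad r u v) = n" using v by simp
  have adj: "mat_adjoint (dyad r v v) = dyad r v v"
    using psd_mat_dyad[OF assms(1) v(1)] by (simp add: psd_mat_def)
  show ?thesis
    unfolding mat_abs_def dim mat_adjoint_dyad_mult_dyad[OF u v(1)]
  proof (rule the_equality)
    show "psd_mat n (dyad r v v) \<and> dyad r v v * dyad r v v = dyad (r\<^sup>2) v v"
      using psd_mat_dyad[OF assms(1) v(1)] mat_adjoint_dyad_mult_dyad[OF v v(1), of r] adj by simp
  qed (use psd_sqrt_dyad_unique[OF assms(1) v] in blast)
qed

section \<open>Singular values, range and rank of a dyad\<close>

text \<open>In dimension at least two, \<open>0\<close> is a singular value as well; only the nonzero part is a singleton.\<close>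

lemma singular_values_dyad:
  assumes r: "0 < r" and u: "u \<in> carrier_vec n" "vec_norm2 u = 1"
    and v: "v \<in> carrier_vec n" "vec_norm2 v = 1"
  shows "singular_values (dyad r u v) - {0} = {r}"
proof -
  have vv: "v \<bullet>c v = 1" using v by (simp add: cscalar_prod_self)
  have v0: "v \<noteq> 0\<^sub>v n" using v vec_norm2_eq_0_iff[OF v(1)] by auto
  have row: "dim_row (dyad (r\<^sup>2) v v) = n" using v by simp
  have "eigenvector (dyad (r\<^sup>2) v v) v (complex_of_real (r\<^sup>2))"
    using v v0 vv dyad_mult_vec[OF v(1) v(1) v(1), of "r\<^sup>2"] unfolding eigenvector_def row by simp
  then have mem: "r \<in> singular_values (dyad r u v)"
    using r by (auto simp: singular_values_def eigenvalue_def mat_adjoint_dyad_mult_dyad[OF u v(1)])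
  moreover have "s = r" if s: "s \<in> singular_values (dyad r u v)" "s \<noteq> 0" for s
  proof -
    obtain w where w: "w \<in> carrier_vec n" "w \<noteq> 0\<^sub>v n"
      and eig: "dyad (r\<^sup>2) v v *\<^sub>v w = complex_of_real (s\<^sup>2) \<cdot>\<^sub>v w" and "0 \<le> s"
      using s(1) unfolding singular_values_def eigenvalue_def eigenvector_def
        mat_adjoint_dyad_mult_dyad[OF u v(1)] mem_Collect_eq row by blast
    have eq: "(complex_of_real (r\<^sup>2) * (w \<bullet>c v)) \<cdot>\<^sub>v v = complex_of_real (s\<^sup>2) \<cdot>\<^sub>v w"
      using eig unfolding dyad_mult_vec[OF v(1) v(1) w(1)] .
    then have "((complex_of_real (r\<^sup>2) * (w \<bullet>c v)) \<cdot>\<^sub>v v) \<bullet>c v = (complex_of_real (s\<^sup>2) \<cdot>\<^sub>v w) \<bullet>c v"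
      by simp
    then have eq2: "complex_of_real (r\<^sup>2) * (w \<bullet>c v) = complex_of_real (s\<^sup>2) * (w \<bullet>c v)"
      using v w vv by (simp add: cscalar_prod_smult_left[of _ n])
    \<comment> \<open>Otherwise \<open>w\<close> would be an eigenvector for \<open>0\<close>, whereas \<open>s \<noteq> 0\<close>.\<close>
    have "w \<bullet>c v \<noteq> 0"
    proof
      assume "w \<bullet>c v = 0"
      then have "complex_of_real (s\<^sup>2) \<cdot>\<^sub>v w = 0 \<cdot>\<^sub>v v" using eq by simp
      then have "\<forall>i<n. (complex_of_real (s\<^sup>2) \<cdot>\<^sub>v w) $ i = (0 \<cdot>\<^sub>v v) $ i" by simp
      then have "\<forall>i<n. w $ i = 0" using w v \<open>s \<noteq> 0\<close> by simp
      then show False using w by (auto intro!: eq_vecI)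
    qed
    then have "s\<^sup>2 = r\<^sup>2" using eq2 by (simp only: mult_cancel_right of_real_eq_iff) auto
    then show "s = r" using \<open>0 \<le> s\<close> r by simp
  qed
  ultimately show ?thesis using r by auto
qed

lemma mat_range_dyad:
  assumes "r \<noteq> 0" and u: "u \<in> carrier_vec n" and v: "v \<in> carrier_vec n" "vec_norm2 v = 1"
  shows "mat_range (dyad r u v) = range (\<lambda>c. c \<cdot>\<^sub>v u)"
proof -
  have vv: "v \<bullet>c v = 1" using v by (simp add: cscalar_prod_self)
  have "c \<cdot>\<^sub>v u \<in> mat_range (dyad r u v)" for c
  proof -
    \<comment> \<open>The multiple of \<open>v\<close> that is mapped to \<open>c u\<close>.\<close>
    have cv: "(c / complex_of_real r) \<cdot>\<^sub>v v \<in> carrier_vec n" using v by simp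
    have "dyad r u v *\<^sub>v ((c / complex_of_real r) \<cdot>\<^sub>v v) = c \<cdot>\<^sub>v u"
      unfolding dyad_mult_vec[OF u v(1) cv] cscalar_prod_smult_left[OF v(1) v(1)] vv
      using \<open>r \<noteq> 0\<close> by simp
    then show ?thesis unfolding mat_range_def using cv v by (metis carrier_vecD image_eqI index_smult_mat(3) outer_prod_dim(2))
  qed
  moreover have "mat_range (dyad r u v) \<subseteq> range (\<lambda>c. c \<cdot>\<^sub>v u)"
    using dyad_mult_vec[OF u v(1)] v by (auto simp: mat_range_def)
  ultimately show ?thesis by auto
qed

context vec_space
begin

lemma lin_indpt_singleton:
  assumes "c \<in> carrier_vec n" "c \<noteq> 0\<^sub>v n"
  shows "lin_indpt {c}"
  using lin_dep_iff_in_span[of "{}" c] assms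
  by (simp add: finite_lin_indpt2 span_empty)

lemma span_singleton:
  assumes "c \<in> carrier_vec n"
  shows "span {c} = range (\<lambda>a. a \<cdot>\<^sub>v c)"
proof -
  have *: "lincomb a {c} = a c \<cdot>\<^sub>v c" for a
    using assms by (simp add: lincomb_def)
  have "span {c} = range (\<lambda>a. a c \<cdot>\<^sub>v c)"
    using finite_span[of "{c}"] assms by (auto simp: *)
  also have "\<dots> = range (\<lambda>a. a \<cdot>\<^sub>v c)"
    by (auto intro: image_eqI[of _ _ "\<lambda>_. _"])
  finally show ?thesis .
qed

lemma rank_le_one_cols:
  assumes "A \<in> carrier_mat n k" and "set (cols A) \<subseteq> {0\<^sub>v n, u}"
  shows "rank A \<le> 1"
proof -
  obtain S where S: "maximal S (\<lambda>T. T \<subseteq> set (cols A) \<and> lin_indpt T)"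
    using maximal_exists[of "(\<lambda>T. T \<subseteq> set (cols A) \<and> lin_indpt T)" "card (set (cols A))" "{}"]
    by (meson List.finite_set card_mono empty_iff empty_subsetI finite_lin_indpt2 rev_finite_subset)
  then have S': "S \<subseteq> set (cols A)" "lin_indpt S" by (auto simp: maximal_def)
  have "set (cols A) \<subseteq> carrier_vec n" using cols_dim assms(1) by blast
  then have "0\<^sub>v n \<notin> S" using vs_zero_lin_dep[of S] S' by auto
  then have "S \<subseteq> {u}" using S' assms(2) by auto
  then have "card S \<le> 1" by (metis card.empty card.insert card_mono empty_iff finite.intros One_nat_def)
  then show ?thesis using rank_card_indpt[OF assms(1) S] by simp
qed

text \<open>Two distinct independent columns would force rank at least two, so every column lies in the span of a nonzero
  one.\<close>

lemma rank_le_one_imp_parallel_cols: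
  assumes A: "A \<in> carrier_mat n n" "rank A \<le> 1"
    and ij: "i < n" "j < n" and nz: "col A j \<noteq> 0\<^sub>v n"
  shows "\<exists>a. col A i = a \<cdot>\<^sub>v col A j"
proof (cases "col A i = col A j")
  case True
  then show ?thesis by (intro exI[of _ 1]) simp
next
  case False
  have c: "col A i \<in> carrier_vec n" "col A j \<in> carrier_vec n" using A by auto
  have sub: "{col A j, col A i} \<subseteq> set (cols A)" using A ij by (auto simp: cols_def)
  have "lin_dep ({col A j} \<union> {col A i})"
  proof (rule ccontr)
    assume "\<not> ?thesis"
    then have "card {col A j, col A i} \<le> rank A"
      using rank_ge_card_indpt[OF A(1) sub] by (simp add: insert_commute)
    then show False using A(2) False by simp
  qed
  then have "col A i \<in> span {col A j}"
    using lin_dep_iff_in_span[of "{col A j}" "col A i"] lin_indpt_singleton[OF c(2) nz] c False by simp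
  then show ?thesis using span_singleton[OF c(2)] by auto
qed

lemma dim_range_smult:
  assumes "c \<in> carrier_vec n" "c \<noteq> 0\<^sub>v n"
  shows "vectorspace.dim class_ring (vs (range (\<lambda>a. a \<cdot>\<^sub>v c))) = 1"
proof -
  have "maximal {c} (\<lambda>T. T \<subseteq> {c} \<and> lin_indpt T)"
    using lin_indpt_singleton[OF assms] by (auto simp: maximal_def)
  then show ?thesis
    using dim_span[of "{c}" "{c}"] assms span_singleton by simp
qed

end


text \<open>All columns are multiples of one nonzero column \<open>c\<close>, so the matrix is \<open>c w\<^sup>*\<close>; normalising both vectors
  collects their norms in \<open>r\<close>. The zero matrix is covered by \<open>r = 0\<close> and arbitrary unit vectors.\<close>

lemma rank_le_one_imp_dyad:
  assumes A: "A \<in> carrier_mat n n" "vec_space.rank n A \<le> 1" and "0 < n"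
  shows "\<exists>r u v. 0 \<le> r \<and> u \<in> carrier_vec n \<and> v \<in> carrier_vec n \<and>
    vec_norm2 u = 1 \<and> vec_norm2 v = 1 \<and> A = dyad r u v"
proof (cases "\<exists>j<n. col A j \<noteq> 0\<^sub>v n")
  case False
  have "A = dyad 0 (unit_vec n 0) (unit_vec n 0)"
  proof (rule eq_matI)
    fix i j assume "i < dim_row (dyad 0 (unit_vec n 0) (unit_vec n 0))"
      "j < dim_col (dyad 0 (unit_vec n 0) (unit_vec n 0))"
    then have ij: "i < n" "j < n" by auto
    then have "col A j $ i = 0" using False by simp
    then show "A $$ (i, j) = dyad 0 (unit_vec n 0) (unit_vec n 0) $$ (i, j)" using ij A by simp
  qed (use A in auto)
  then show ?thesis
    using vec_norm2_unit_vec[OF \<open>0 < n\<close>] unit_vec_carrier[of n 0] by blast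
next
  case True
  then obtain j where j: "j < n" "col A j \<noteq> 0\<^sub>v n" by blast
  define c where "c = col A j"
  have c: "c \<in> carrier_vec n" "c \<noteq> 0\<^sub>v n" using j A by (auto simp: c_def)
  have "\<forall>i<n. \<exists>a. col A i = a \<cdot>\<^sub>v c"
    using vec_space.rank_le_one_imp_parallel_cols[OF A _ j(1) j(2)] by (simp add: c_def)
  then obtain a where a: "\<And>i. i < n \<Longrightarrow> col A i = a i \<cdot>\<^sub>v c" by metis
  define w where "w = vec n (\<lambda>i. cnj (a i))"
  have w: "w \<in> carrier_vec n" by (simp add: w_def)
  have entry: "A $$ (i, k) = c $ i * cnj (w $ k)" if "i < n" "k < n" for i k
  proof -
    have "A $$ (i, k) = col A k $ i" using that A by simp
    then show ?thesis using that c by (simp add: a w_def)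
  qed
  have "w \<noteq> 0\<^sub>v n"
  proof
    assume "w = 0\<^sub>v n"
    then have "c = 0\<^sub>v n" using entry j(1) A by (intro eq_vecI) (auto simp: c_def)
    then show False using c by simp
  qed
  then have pos: "0 < vec_norm2 c" "0 < vec_norm2 w"
    using c w vec_norm2_nonneg[of c] vec_norm2_nonneg[of w] vec_norm2_eq_0_iff[of c n]
      vec_norm2_eq_0_iff[of w n] by auto
  define c' where "c' = complex_of_real (1 / vec_norm2 c) \<cdot>\<^sub>v c"
  define w' where "w' = complex_of_real (1 / vec_norm2 w) \<cdot>\<^sub>v w"
  have "A = dyad (vec_norm2 c * vec_norm2 w) c' w'"
    by (rule eq_matI) (use A c w pos in \<open>auto simp: c'_def w'_def outer_prod_index entry\<close>)
  moreover have "vec_norm2 c' = 1" "vec_norm2 w' = 1"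
    unfolding c'_def w'_def vec_norm2_smult norm_of_real using pos by simp_all
  moreover have "c' \<in> carrier_vec n" "w' \<in> carrier_vec n" using c w by (simp_all add: c'_def w'_def)
  ultimately show ?thesis using pos by (intro exI[of _ "vec_norm2 c * vec_norm2 w"]) auto
qed

section \<open>The norm inequality for a family of dyads\<close>

lemma dyad_sum_mult_vec:
  assumes a: "\<And>k. k \<in> {1..m} \<Longrightarrow> a k \<in> carrier_vec n"
    and b: "\<And>k. k \<in> {1..m} \<Longrightarrow> b k \<in> carrier_vec n"
    and B: "\<And>k. k \<in> {1..m} \<Longrightarrow> B k = dyad (r k) (a k) (b k)"
    and x: "x \<in> carrier_vec n"
  shows "mat_family_sum n m B *\<^sub>v x
    = lincomb_vec n {1..m} (\<lambda>k. complex_of_real (r k) * (x \<bullet>c b k)) a"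
proof (rule eq_vecI)
  fix i assume "i < dim_vec (lincomb_vec n {1..m} (\<lambda>k. complex_of_real (r k) * (x \<bullet>c b k)) a)"
  then have i: "i < n" by (simp add: lincomb_vec_def)
  have "(mat_family_sum n m B *\<^sub>v x) $ i = (\<Sum>j<n. \<Sum>k=1..m. B k $$ (i, j) * x $ j)"
    using i x by (auto simp: mat_family_sum_def scalar_prod_def sum_distrib_right atLeast0LessThan
        intro!: sum.cong)
  also have "\<dots> = (\<Sum>k=1..m. \<Sum>j<n. B k $$ (i, j) * x $ j)" by (rule sum.swap)
  also have "\<dots> = (\<Sum>k=1..m. complex_of_real (r k) * (x \<bullet>c b k) * a k $ i)"
  proof (rule sum.cong[OF refl])
    fix k assume k: "k \<in> {1..m}"
    have "(\<Sum>j<n. B k $$ (i, j) * x $ j)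
        = (\<Sum>j<n. complex_of_real (r k) * (x $ j * cnj (b k $ j)) * a k $ i)"
      by (rule sum.cong[OF refl])
         (use i a[OF k] b[OF k] in \<open>simp add: B[OF k] outer_prod_index mult_ac\<close>)
    then show "(\<Sum>j<n. B k $$ (i, j) * x $ j) = complex_of_real (r k) * (x \<bullet>c b k) * a k $ i"
      by (simp add: cscalar_prod_eq_sum[OF b[OF k]] sum_distrib_left sum_distrib_right)
  qed
  also have "\<dots> = lincomb_vec n {1..m} (\<lambda>k. complex_of_real (r k) * (x \<bullet>c b k)) a $ i"
    using i by (simp add: lincomb_vec_def)
  finally show "(mat_family_sum n m B *\<^sub>v x) $ i
    = lincomb_vec n {1..m} (\<lambda>k. complex_of_real (r k) * (x \<bullet>c b k)) a $ i" .
qed (simp add: mat_family_sum_def lincomb_vec_def)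

text \<open>The families that attain equality.\<close>

definition extremal_family :: "nat \<Rightarrow> nat \<Rightarrow> (nat \<Rightarrow> complex mat) \<Rightarrow> bool" where
  "extremal_family n m A \<longleftrightarrow>
     (\<exists>r > 0. \<exists>u \<in> carrier_vec n. \<exists>v.
        vec_norm2 u = 1 \<and>
        (\<forall>k \<in> {1..m}. v k \<in> carrier_vec n) \<and>
        (\<forall>j \<in> {1..m}. \<forall>k \<in> {1..m}. v j \<bullet>c v k = (if j = k then 1 else 0)) \<and>
        (\<forall>k \<in> {1..m}. A k = dyad r u (v k)))"

text \<open>Moves the phase of a left vector to the right vector.\<close>

lemma outer_prod_smult_left: "outer_prod (c \<cdot>\<^sub>v u) v = outer_prod u (cnj c \<cdot>\<^sub>v v)"
  by (rule eq_matI) (auto simp: outer_prod_index)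

text \<open>A family of matrices of rank at most one, with a chosen decomposition. Zero members are allowed: they
  have \<open>r k = 0\<close>, with arbitrary unit vectors.\<close>

locale dyad_family =
  fixes n m :: nat and A :: "nat \<Rightarrow> complex mat"
    and r :: "nat \<Rightarrow> real" and u v :: "nat \<Rightarrow> complex vec"
  assumes n_pos: "0 < n"
    and r_nonneg: "k \<in> {1..m} \<Longrightarrow> 0 \<le> r k"
    and u: "k \<in> {1..m} \<Longrightarrow> u k \<in> carrier_vec n" and norm_u: "k \<in> {1..m} \<Longrightarrow> vec_norm2 (u k) = 1"
    and v: "k \<in> {1..m} \<Longrightarrow> v k \<in> carrier_vec n" and norm_v: "k \<in> {1..m} \<Longrightarrow> vec_norm2 (v k) = 1"
    and A_eq: "k \<in> {1..m} \<Longrightarrow> A k = dyad (r k) (u k) (v k)"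
    and nonzero: "\<exists>k \<in> {1..m}. 0 < r k"
begin

abbreviation S :: "complex mat" where "S \<equiv> mat_family_sum n m A"
abbreviation P :: "complex mat" where "P \<equiv> mat_family_sum n m (\<lambda>k. mat_abs (A k))"
abbreviation M :: real where "M \<equiv> op_norm P"

lemma S_carrier: "S \<in> carrier_mat n n" and P_carrier: "P \<in> carrier_mat n n"
  by (simp_all add: mat_family_sum_def)

lemma S_mult_vec:
  "x \<in> carrier_vec n \<Longrightarrow>
    S *\<^sub>v x = lincomb_vec n {1..m} (\<lambda>k. complex_of_real (r k) * (x \<bullet>c v k)) u"
  by (rule dyad_sum_mult_vec) (auto simp: u v A_eq)

lemma P_mult_vec:
  "x \<in> carrier_vec n \<Longrightarrow>
    P *\<^sub>v x = lincomb_vec n {1..m} (\<lambda>k. complex_of_real (r k) * (x \<bullet>c v k)) v"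
  by (rule dyad_sum_mult_vec) (auto simp: u v norm_u norm_v A_eq r_nonneg mat_abs_dyad[of _ _ n])

text \<open>The left-hand side is \<open>\<langle>P x, x\<rangle>\<close>. Evaluated at the right vectors \<open>v\<^sub>j\<close> it bounds the weights
  \<open>r\<^sub>j\<close> and, in the equality case, forces orthogonality.\<close>

lemma quadratic_form_le:
  assumes x: "x \<in> carrier_vec n" "vec_norm2 x = 1"
  shows "(\<Sum>k=1..m. r k * (cmod (x \<bullet>c v k))\<^sup>2) \<le> M"
proof -
  have Px: "P *\<^sub>v x \<in> carrier_vec n" using P_carrier x by auto
  have "(P *\<^sub>v x) \<bullet>c x = (\<Sum>k=1..m. complex_of_real (r k) * (x \<bullet>c v k) * cnj (x \<bullet>c v k))"
    unfolding P_mult_vec[OF x(1)] lincomb_vec_cscalar_prod[OF x(1)]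
    by (rule sum.cong[OF refl]) (simp add: cscalar_prod_commute[OF x(1) v])
  also have "\<dots> = complex_of_real (\<Sum>k=1..m. r k * (cmod (x \<bullet>c v k))\<^sup>2)"
    by (simp add: complex_norm_square mult.assoc del: of_real_power)
  finally have "(\<Sum>k=1..m. r k * (cmod (x \<bullet>c v k))\<^sup>2) = Re ((P *\<^sub>v x) \<bullet>c x)" by simp
  also have "\<dots> \<le> cmod ((P *\<^sub>v x) \<bullet>c x)" by (rule complex_Re_le_cmod)
  also have "\<dots> \<le> vec_norm2 (P *\<^sub>v x)" using Cauchy_Schwarz_vec[OF Px x(1)] x(2) by simp
  also have "\<dots> \<le> M" by (rule vec_norm2_le_op_norm[OF P_carrier x])
  finally show ?thesis .
qed

lemma v_self: "k \<in> {1..m} \<Longrightarrow> v k \<bullet>c v k = 1"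
  by (simp add: cscalar_prod_self norm_v)

lemma r_le: "j \<in> {1..m} \<Longrightarrow> r j \<le> M"
proof -
  assume j: "j \<in> {1..m}"
  have "r j * (cmod (v j \<bullet>c v j))\<^sup>2 \<le> (\<Sum>k=1..m. r k * (cmod (v j \<bullet>c v k))\<^sup>2)"
    by (rule member_le_sum) (use j r_nonneg in auto)
  then show "r j \<le> M" using quadratic_form_le[OF v[OF j] norm_v[OF j]] by (simp add: v_self[OF j])
qed

lemma M_pos: "0 < M"
  using nonzero r_le by fastforce

lemma gram_le_1: "j \<in> {1..m} \<Longrightarrow> k \<in> {1..m} \<Longrightarrow> cmod (u j \<bullet>c u k) \<le> 1"
  using Cauchy_Schwarz_vec[OF u u, of j k] norm_u by simp

lemma op_norm_S_le_sqrt: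
  assumes G: "\<And>j. j \<in> {1..m} \<Longrightarrow> (\<Sum>k=1..m. r k * cmod (u j \<bullet>c u k)) \<le> G"
  shows "op_norm S \<le> sqrt (G * M)"
proof (rule op_norm_le[OF S_carrier n_pos])
  fix x :: "complex vec" assume x: "x \<in> carrier_vec n" "vec_norm2 x = 1"
  obtain j where j: "j \<in> {1..m}" using nonzero by auto
  have "0 \<le> (\<Sum>k=1..m. r k * cmod (u j \<bullet>c u k))" by (intro sum_nonneg) (simp add: r_nonneg)
  then have "0 \<le> G" using G[OF j] by simp
  have "(vec_norm2 (S *\<^sub>v x))\<^sup>2 \<le> G * (\<Sum>k=1..m. r k * (cmod (x \<bullet>c v k))\<^sup>2)"
    unfolding S_mult_vec[OF x(1)] by (rule weighted_Schur_test[OF r_nonneg u G])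
  also have "\<dots> \<le> G * M" by (intro mult_left_mono quadratic_form_le x \<open>0 \<le> G\<close>)
  finally show "vec_norm2 (S *\<^sub>v x) \<le> sqrt (G * M)" by (rule real_le_rsqrt)
qed

lemma sqrt_m_M: "sqrt (real m * M * M) = sqrt (real m) * M"
  using M_pos by (simp add: real_sqrt_mult)

lemma op_norm_S_le: "op_norm S \<le> sqrt (real m) * M"
proof -
  have "(\<Sum>k=1..m. r k * cmod (u j \<bullet>c u k)) \<le> real m * M" if j: "j \<in> {1..m}" for j
  proof -
    have "(\<Sum>k=1..m. r k * cmod (u j \<bullet>c u k)) \<le> (\<Sum>k=1..m. M * 1)"
      by (intro sum_mono mult_mono) (use j r_le r_nonneg gram_le_1 M_pos in auto)
    then show ?thesis by simp
  qed
  then show ?thesis using op_norm_S_le_sqrt sqrt_m_M by metis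
qed

text \<open>If every weighted row sum of the Gram matrix were below \<open>m M\<close>, then so would be their maximum \<open>G\<close>, and
  \<open>\<surd>(G M) < \<surd>m \<cdot> M\<close> would bound the norm of \<open>S\<close>. A row sum equal to \<open>m M\<close> leaves no slack in any
  of its \<open>m\<close> terms.\<close>

lemma equality_imp_aligned:
  assumes eq: "op_norm S = sqrt (real m) * M"
  shows "\<exists>j\<in>{1..m}. \<forall>k\<in>{1..m}. r k = M \<and> cmod (u j \<bullet>c u k) = 1"
proof (rule ccontr)
  assume "\<not> ?thesis"
  then have ex: "\<exists>k\<in>{1..m}. \<not> (r k = M \<and> cmod (u j \<bullet>c u k) = 1)" if "j \<in> {1..m}" for j
    using that by blast
  define row where "row j = (\<Sum>k=1..m. r k * cmod (u j \<bullet>c u k))" for j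
  have row_less: "row j < real m * M" if j: "j \<in> {1..m}" for j
  proof -
    have "row j < (\<Sum>k=1..m. M)" unfolding row_def
    proof (rule sum_strict_mono_ex1)
      show "\<forall>k\<in>{1..m}. r k * cmod (u j \<bullet>c u k) \<le> M"
      proof
        fix k assume k: "k \<in> {1..m}"
        have "r k * cmod (u j \<bullet>c u k) \<le> M * 1"
          by (intro mult_mono) (use j k r_le r_nonneg gram_le_1 M_pos in auto)
        then show "r k * cmod (u j \<bullet>c u k) \<le> M" by simp
      qed
      obtain k where k: "k \<in> {1..m}" "\<not> (r k = M \<and> cmod (u j \<bullet>c u k) = 1)" using ex[OF j] by blast
      have "r k * cmod (u j \<bullet>c u k) < M"
      proof (cases "r k = M")
        case True
        then have "cmod (u j \<bullet>c u k) < 1" using k gram_le_1[OF j k(1)] by linarith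
        then show ?thesis using True M_pos by simp
      next
        case False
        have "r k * cmod (u j \<bullet>c u k) \<le> r k * 1"
          by (intro mult_left_mono gram_le_1 j k(1) r_nonneg)
        also have "\<dots> < M" using r_le[OF k(1)] False by simp
        finally show ?thesis .
      qed
      then show "\<exists>k\<in>{1..m}. r k * cmod (u j \<bullet>c u k) < M" using k(1) by blast
    qed simp
    then show ?thesis by simp
  qed
  define G where "G = Max (row ` {1..m})"
  have ne: "row ` {1..m} \<noteq> {}" using nonzero by auto
  have "op_norm S \<le> sqrt (G * M)"
  proof (rule op_norm_S_le_sqrt)
    fix j assume "j \<in> {1..m}"
    then have "row j \<le> G" unfolding G_def by (intro Max_ge) auto
    then show "(\<Sum>k=1..m. r k * cmod (u j \<bullet>c u k)) \<le> G" by (simp only: row_def)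
  qed
  moreover have "G < real m * M" using ne row_less by (simp add: G_def)
  then have "sqrt (G * M) < sqrt (real m * M * M)" using M_pos by simp
  ultimately show False using eq sqrt_m_M by simp
qed

lemma equality_imp_extremal:
  assumes eq: "op_norm S = sqrt (real m) * M"
  shows "extremal_family n m A"
proof -
  obtain j where j: "j \<in> {1..m}"
    and al: "\<And>k. k \<in> {1..m} \<Longrightarrow> r k = M \<and> cmod (u j \<bullet>c u k) = 1"
    using equality_imp_aligned[OF eq] by blast
  have v_orth: "v i \<bullet>c v k = 0" if ik: "i \<in> {1..m}" "k \<in> {1..m}" "i \<noteq> k" for i k
  proof -
    \<comment> \<open>The \<open>i\<close>-th term of the quadratic form at \<open>v\<^sub>i\<close> is already \<open>M\<close>, leaving nothing for the \<open>k\<close>-th.\<close>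
    have "(\<Sum>l\<in>{i,k}. r l * (cmod (v i \<bullet>c v l))\<^sup>2) \<le> (\<Sum>l=1..m. r l * (cmod (v i \<bullet>c v l))\<^sup>2)"
      by (rule sum_mono2) (use ik r_nonneg in auto)
    also have "\<dots> \<le> M" by (rule quadratic_form_le[OF v norm_v]) (use ik in auto)
    finally have "M + M * (cmod (v i \<bullet>c v k))\<^sup>2 \<le> M" using ik al v_self by simp
    then have "M * (cmod (v i \<bullet>c v k))\<^sup>2 \<le> M * 0" by simp
    then have "(cmod (v i \<bullet>c v k))\<^sup>2 \<le> 0" using M_pos by (simp only: mult_le_cancel_left_pos)
    then show ?thesis by simp
  qed
  define a where "a k = u k \<bullet>c u j" for k
  \<comment> \<open>\<open>u\<^sub>k = a\<^sub>k u\<^sub>j\<close> with a phase \<open>a\<^sub>k\<close>, which \<open>w\<^sub>k\<close> absorbs.\<close>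
  define w where "w k = cnj (a k) \<cdot>\<^sub>v v k" for k
  have cmod_a: "cmod (a k) = 1" if "k \<in> {1..m}" for k
    using al[OF that] cscalar_prod_commute[OF u u, OF j that] by (simp add: a_def)
  have w: "w k \<in> carrier_vec n" if "k \<in> {1..m}" for k using v[OF that] by (simp add: w_def)
  have ww: "w i \<bullet>c w k = (if i = k then 1 else 0)" if ik: "i \<in> {1..m}" "k \<in> {1..m}" for i k
  proof -
    have "w i \<bullet>c w k = cnj (a i) * (a k * (v i \<bullet>c v k))"
      using ik v by (simp add: w_def cscalar_prod_smult_left[of _ n] cscalar_prod_smult_right[of _ n])
    then show ?thesis
      using ik v_orth v_self cmod_a[OF ik(2)] complex_norm_square[of "a k"] by (auto simp: mult.commute)
  qed
  have "A k = dyad M (u j) (w k)" if k: "k \<in> {1..m}" for k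
  proof -
    have "u k = a k \<cdot>\<^sub>v u j" unfolding a_def
      by (rule unit_vec_parallel[OF u u norm_u norm_u]) (use k j cmod_a in \<open>auto simp: a_def\<close>)
    then show ?thesis using A_eq[OF k] al[OF k] outer_prod_smult_left by (simp add: w_def)
  qed
  then show ?thesis
    unfolding extremal_family_def using M_pos u[OF j] norm_u[OF j] w ww by blast
qed

end

section \<open>Extremal families\<close>

lemma extremal_family_card_le:
  assumes "extremal_family n m A"
  shows "m \<le> n"
proof -
  obtain v :: "nat \<Rightarrow> complex vec" where "\<forall>k\<in>{1..m}. v k \<in> carrier_vec n"
    "\<forall>j\<in>{1..m}. \<forall>k\<in>{1..m}. v j \<bullet>c v k = (if j = k then 1 else 0)"
    using assms unfolding extremal_family_def by blast
  then show ?thesis using orthonormal_family_card_le[of "{1..m}" v n] by simp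
qed

text \<open>The weighted Schur test, now applied to the orthonormal right vectors, and Bessel's inequality give
  \<open>M \<le> r\<close>. The normalised sum of the right vectors shows that the norm of \<open>S\<close> is at least
  \<open>\<surd>m \<cdot> r\<close>; the general inequality closes the chain.\<close>

lemma extremal_family_imp_equality:
  assumes ext: "extremal_family n m A" and "0 < n" "0 < m"
  shows "norm_of_sum n m A = sqrt (real m) * norm_of_abs_sum n m A"
proof -
  obtain r u v where r: "0 < r" and u0: "u \<in> carrier_vec n" "vec_norm2 u = 1"
    and v: "\<And>k. k \<in> {1..m} \<Longrightarrow> v k \<in> carrier_vec n"
    and vv: "\<And>j k. j \<in> {1..m} \<Longrightarrow> k \<in> {1..m} \<Longrightarrow> v j \<bullet>c v k = (if j = k then 1 else 0)"
    and A: "\<And>k. k \<in> {1..m} \<Longrightarrow> A k = dyad r u (v k)"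
    using ext unfolding extremal_family_def by blast
  interpret dyad_family n m A "\<lambda>_. r" "\<lambda>_. u" v
    using assms r u0 v A by unfold_locales (auto simp: vec_norm2_def vv)
  have "M \<le> r"
  proof (rule op_norm_le[OF P_carrier n_pos])
    fix x :: "complex vec" assume x: "x \<in> carrier_vec n" "vec_norm2 x = 1"
    have "(vec_norm2 (P *\<^sub>v x))\<^sup>2 \<le> r * (\<Sum>k=1..m. r * (cmod (x \<bullet>c v k))\<^sup>2)"
      unfolding P_mult_vec[OF x(1)]
    proof (rule weighted_Schur_test)
      fix j assume "j \<in> {1..m}"
      then have "(\<Sum>k=1..m. r * cmod (v j \<bullet>c v k)) = (\<Sum>k=1..m. if j = k then r else 0)"
        by (intro sum.cong) (auto simp: vv)
      then show "(\<Sum>k=1..m. r * cmod (v j \<bullet>c v k)) \<le> r" using \<open>j \<in> {1..m}\<close> by simp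
    qed (use r v in auto)
    also have "\<dots> = r\<^sup>2 * (\<Sum>k=1..m. (cmod (x \<bullet>c v k))\<^sup>2)"
      by (simp add: sum_distrib_left power2_eq_square mult.assoc)
    also have "\<dots> \<le> r\<^sup>2 * 1"
      using Bessel_inequality[of "{1..m}" v n x] v vv x by (intro mult_left_mono) auto
    finally have "(vec_norm2 (P *\<^sub>v x))\<^sup>2 \<le> r\<^sup>2" by simp
    then show "vec_norm2 (P *\<^sub>v x) \<le> r" by (rule power2_le_imp_le) (use r in simp)
  qed
  let ?q = "complex_of_real (1 / sqrt (real m))"
  define x where "x = lincomb_vec n {1..m} (\<lambda>_. ?q) v"
  have x: "x \<in> carrier_vec n" by (simp add: x_def)
  have q: "?q * ?q = 1 / of_nat m"
    by (simp only: of_real_mult[symmetric]) (simp add: real_sqrt_mult[symmetric])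
  have xv: "x \<bullet>c v k = ?q" if k: "k \<in> {1..m}" for k
  proof -
    have "x \<bullet>c v k = (\<Sum>j=1..m. if j = k then ?q else 0)"
      unfolding x_def lincomb_vec_cscalar_prod[OF v[OF k]]
      by (rule sum.cong) (auto simp: vv[OF _ k])
    then show ?thesis using k by simp
  qed
  have "x \<bullet>c x = (\<Sum>k=1..m. cnj ?q * (x \<bullet>c v k))"
    by (subst (2) x_def) (simp only: cscalar_prod_lincomb_vec[OF x v])
  also have "\<dots> = (\<Sum>k=1..m. 1 / of_nat m)"
    by (rule sum.cong) (use q xv in auto)
  also have "\<dots> = 1" using \<open>0 < m\<close> by simp
  finally have nx: "vec_norm2 x = 1" by (simp add: vec_norm2_def)
  have "S *\<^sub>v x = (complex_of_real (sqrt (real m) * r)) \<cdot>\<^sub>v u"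
  proof (rule eq_vecI)
    fix i assume "i < dim_vec (complex_of_real (sqrt (real m) * r) \<cdot>\<^sub>v u)"
    then have i: "i < n" using u0 by simp
    have "(S *\<^sub>v x) $ i = (\<Sum>k=1..m. complex_of_real r * ?q * u $ i)"
      using i xv by (simp add: S_mult_vec[OF x] lincomb_vec_def)
    also have "\<dots> = complex_of_real (real m / sqrt (real m)) * complex_of_real r * u $ i" by simp
    also have "real m / sqrt (real m) = sqrt (real m)" by (simp add: real_div_sqrt)
    finally show "(S *\<^sub>v x) $ i = (complex_of_real (sqrt (real m) * r) \<cdot>\<^sub>v u) $ i"
      using i u0 by simp
  qed (use u0 in \<open>simp add: mat_family_sum_def\<close>)
  then have "vec_norm2 (S *\<^sub>v x) = sqrt (real m) * r"
    using u0 r by (simp add: vec_norm2_smult norm_mult)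
  then have "sqrt (real m) * r \<le> op_norm S"
    using vec_norm2_le_op_norm[OF S_carrier x nx] by simp
  moreover have "sqrt (real m) * M \<le> sqrt (real m) * r" using \<open>M \<le> r\<close> by (simp add: mult_left_mono)
  ultimately show ?thesis using op_norm_S_le by simp
qed

text \<open>From right to left, the common singular value is \<open>s = r\<^sub>k\<close>, and the common range makes every left
  vector a multiple of the first one by a phase, which is absorbed into the right vector.\<close>

lemma extremal_family_iff_intrinsic:
  assumes A: "\<And>k. k \<in> {1..m} \<Longrightarrow> A k \<in> carrier_mat n n" and "0 < m"
  shows "extremal_family n m A \<longleftrightarrow>
    (\<forall>k \<in> {1..m}. A k \<noteq> 0\<^sub>m n n) \<and>
    (\<exists>s. \<forall>k \<in> {1..m}. singular_values (A k) - {0} = {s}) \<and>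
    (\<exists>W. subspace_dim n W = 1 \<and> (\<forall>k \<in> {1..m}. mat_range (A k) = W)) \<and>
    (\<exists>v. (\<forall>k \<in> {1..m}. right_vector (A k) (v k)) \<and>
         (\<forall>j \<in> {1..m}. \<forall>k \<in> {1..m}. j \<noteq> k \<longrightarrow> v j \<bullet>c v k = 0))"
    (is "_ \<longleftrightarrow> ?nz \<and> ?sv \<and> ?rg \<and> ?rv")
proof
  assume "extremal_family n m A"
  then obtain r u v where r: "0 < r" and u: "u \<in> carrier_vec n" "vec_norm2 u = 1"
    and v: "\<And>k. k \<in> {1..m} \<Longrightarrow> v k \<in> carrier_vec n"
    and vv: "\<And>j k. j \<in> {1..m} \<Longrightarrow> k \<in> {1..m} \<Longrightarrow> v j \<bullet>c v k = (if j = k then 1 else 0)"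
    and Ak: "\<And>k. k \<in> {1..m} \<Longrightarrow> A k = dyad r u (v k)"
    unfolding extremal_family_def by blast
  have nv: "vec_norm2 (v k) = 1" if "k \<in> {1..m}" for k using vv[OF that that] by (simp add: vec_norm2_def)
  have sv: "\<forall>k\<in>{1..m}. singular_values (A k) - {0} = {r}"
    using singular_values_dyad[OF r u v nv] Ak by simp
  have rg: "\<forall>k\<in>{1..m}. mat_range (A k) = range (\<lambda>c. c \<cdot>\<^sub>v u)"
    using mat_range_dyad[OF _ u(1) v nv, of r] r Ak by simp
  have u0: "u \<noteq> 0\<^sub>v n" using u vec_norm2_eq_0_iff[OF u(1)] by auto
  have dim: "subspace_dim n (range (\<lambda>c. c \<cdot>\<^sub>v u)) = 1"
    unfolding subspace_dim_def using vec_space.dim_range_smult[OF u(1) u0] .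
  have nz: ?nz
  proof (intro ballI notI)
    fix k assume k: "k \<in> {1..m}" and "A k = 0\<^sub>m n n"
    \<comment> \<open>The scalar \<open>1\<close> brings \<open>u\<close> into the form of an element of the range \<open>{c u}\<close>.\<close>
    then have "1 \<cdot>\<^sub>v u \<in> mat_range (0\<^sub>m n n)" using rg by (metis rangeI)
    then show False using u0 by (auto simp: mat_range_def)
  qed
  have rv: ?rv
    using r u nv Ak vv unfolding right_vector_def by (intro exI[of _ v]) auto
  show "?nz \<and> ?sv \<and> ?rg \<and> ?rv" using nz sv rg dim rv by blast
next
  assume "?nz \<and> ?sv \<and> ?rg \<and> ?rv"
  then obtain s W v where sv: "\<And>k. k \<in> {1..m} \<Longrightarrow> singular_values (A k) - {0} = {s}"
    and rg: "\<And>k. k \<in> {1..m} \<Longrightarrow> mat_range (A k) = W"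
    and rv: "\<And>k. k \<in> {1..m} \<Longrightarrow> right_vector (A k) (v k)"
    and vv: "\<And>j k. j \<in> {1..m} \<Longrightarrow> k \<in> {1..m} \<Longrightarrow> j \<noteq> k \<Longrightarrow> v j \<bullet>c v k = 0"
    by metis
  have "\<forall>k\<in>{1..m}. \<exists>r u. 0 < r \<and> vec_norm2 u = 1 \<and> A k = dyad r u (v k)"
    using rv unfolding right_vector_def by blast
  then obtain r u where r: "\<And>k. k \<in> {1..m} \<Longrightarrow> 0 < r k"
    and nu: "\<And>k. k \<in> {1..m} \<Longrightarrow> vec_norm2 (u k) = 1"
    and Ak: "\<And>k. k \<in> {1..m} \<Longrightarrow> A k = dyad (r k) (u k) (v k)"
    by metis
  have nv: "vec_norm2 (v k) = 1" if "k \<in> {1..m}" for k using rv[OF that] by (simp add: right_vector_def)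
  have u: "u k \<in> carrier_vec n" and v: "v k \<in> carrier_vec n" if "k \<in> {1..m}" for k
    using carrier_matD[OF A[OF that]] unfolding Ak[OF that] by (auto intro: carrier_vecI)
  have rs: "r k = s" if "k \<in> {1..m}" for k
    using singular_values_dyad[OF r u nu v nv] sv Ak that by fastforce
  have one: "1 \<in> {1..m}" using \<open>0 < m\<close> by simp
  have "\<exists>c. u k = c \<cdot>\<^sub>v u 1" if k: "k \<in> {1..m}" for k
  proof -
    have range: "range (\<lambda>c. c \<cdot>\<^sub>v u i) = W" if i: "i \<in> {1..m}" for i
      using mat_range_dyad[OF _ u[OF i] v[OF i] nv[OF i], of "r i"] r[OF i] rg[OF i] Ak[OF i] by simp
    have "1 \<cdot>\<^sub>v u k \<in> range (\<lambda>c. c \<cdot>\<^sub>v u 1)" using range[OF k] range[OF one] by blast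
    then show ?thesis by auto
  qed
  then obtain c where c: "\<And>k. k \<in> {1..m} \<Longrightarrow> u k = c k \<cdot>\<^sub>v u 1" by metis
  have cmod_c: "cmod (c k) = 1" if "k \<in> {1..m}" for k
    using nu[OF that] nu[OF one] c[OF that] vec_norm2_smult[of "c k" "u 1"] by simp
  define w where "w k = cnj (c k) \<cdot>\<^sub>v v k" for k
  have w: "w k \<in> carrier_vec n" if "k \<in> {1..m}" for k using v[OF that] by (simp add: w_def)
  have ww: "w i \<bullet>c w k = (if i = k then 1 else 0)" if ik: "i \<in> {1..m}" "k \<in> {1..m}" for i k
  proof -
    have "w i \<bullet>c w k = cnj (c i) * (c k * (v i \<bullet>c v k))"
      using ik v by (simp add: w_def cscalar_prod_smult_left[of _ n] cscalar_prod_smult_right[of _ n])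
    then show ?thesis
      using ik vv nv cscalar_prod_self[of "v k"] cmod_c[OF ik(2)] complex_norm_square[of "c k"]
      by (auto simp: mult.commute)
  qed
  have "A k = dyad s (u 1) (w k)" if k: "k \<in> {1..m}" for k
    using Ak[OF k] rs[OF k] c[OF k] outer_prod_smult_left by (metis w_def)
  then show "extremal_family n m A"
    unfolding extremal_family_def using r[OF one] rs[OF one] u[OF one] nu[OF one] w ww by blast
qed

lemma rank_le_one_family_imp_dyad_family:
  assumes fam: "rank_le_one_family n m A" and n: "0 < n"
  obtains r u v where "dyad_family n m A r u v"
proof -
  have A: "A k \<in> carrier_mat n n" "vec_space.rank n (A k) \<le> 1" if "k \<in> {1..m}" for k
    using fam that by (auto simp: rank_le_one_family_def)
  have "\<forall>k\<in>{1..m}. \<exists>r u v. 0 \<le> r \<and> u \<in> carrier_vec n \<and> v \<in> carrier_vec n \<and>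
      vec_norm2 u = 1 \<and> vec_norm2 v = 1 \<and> A k = dyad r u v"
    using rank_le_one_imp_dyad[OF A n] by blast
  then obtain r u v where *: "\<And>k. k \<in> {1..m} \<Longrightarrow> 0 \<le> r k \<and> u k \<in> carrier_vec n \<and>
      v k \<in> carrier_vec n \<and> vec_norm2 (u k) = 1 \<and> vec_norm2 (v k) = 1 \<and>
      A k = dyad (r k) (u k) (v k)" by metis
  obtain k where k: "k \<in> {1..m}" "A k \<noteq> 0\<^sub>m n n" using fam by (auto simp: rank_le_one_family_def)
  have "r k \<noteq> 0"
  proof
    assume "r k = 0"
    then have "A k = 0\<^sub>m n n" using *[OF k(1)] by (intro eq_matI) auto
    then show False using k by simp
  qed
  then have "0 < r k" using *[OF k(1)] by simp
  then have "dyad_family n m A r u v" using * n k(1) by unfold_locales blast+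
  then show thesis by (rule that)
qed

text \<open>The matrix units \<open>E\<^sub>1\<^sub>k\<close>. Vectors are indexed from \<open>0\<close> but families from \<open>1\<close>, hence \<open>k - 1\<close>.\<close>

definition standard_row_family :: "nat \<Rightarrow> nat \<Rightarrow> complex mat" where
  "standard_row_family m k = dyad 1 (unit_vec m 0) (unit_vec m (k - 1))"

lemma extremal_standard_row_family:
  assumes "0 < m"
  shows "extremal_family m m (standard_row_family m)"
  unfolding extremal_family_def standard_row_family_def
  using assms
  by (intro exI[of _ 1] conjI bexI[of _ "unit_vec m 0"] exI[of _ "\<lambda>k. unit_vec m (k - 1)"])
     (auto simp: vec_norm2_unit_vec scalar_prod_left_unit conjugate_complex_def)

lemma rank_le_one_standard_row_family:
  assumes "0 < m"
  shows "rank_le_one_family m m (standard_row_family m)"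
  unfolding rank_le_one_family_def
proof (intro conjI ballI bexI)
  fix k assume k: "k \<in> {1..m}"
  let ?B = "standard_row_family m k"
  show B: "?B \<in> carrier_mat m m" by (simp add: standard_row_family_def outer_prod_carrier)
  have km: "k - 1 < m" using k by auto
  have "col ?B j \<in> {0\<^sub>v m, unit_vec m 0}" if "j < m" for j
  proof (cases "j = k - 1")
    case True
    then have "col ?B j = unit_vec m 0"
      using that km by (intro eq_vecI) (auto simp: standard_row_family_def outer_prod_index)
    then show ?thesis by simp
  next
    case False
    then have "col ?B j = 0\<^sub>v m"
      using that km by (intro eq_vecI) (auto simp: standard_row_family_def outer_prod_index)
    then show ?thesis by simp
  qed
  then have "set (cols ?B) \<subseteq> {0\<^sub>v m, unit_vec m 0}" using B by (fastforce simp: cols_def)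
  then show "vec_space.rank m ?B \<le> 1" by (rule vec_space.rank_le_one_cols[OF B])
next
  show "standard_row_family m 1 \<noteq> 0\<^sub>m m m"
  proof
    assume "standard_row_family m 1 = 0\<^sub>m m m"
    then have "standard_row_family m 1 $$ (0, 0) = 0\<^sub>m m m $$ (0, 0)" by simp
    then show False using assms by (simp add: standard_row_family_def outer_prod_index)
  qed
  show "1 \<in> {1..m}" using assms by simp
qed

theorem corollary3p1:
  fixes m :: nat
  assumes "2 \<le> m"
  shows
    "(\<forall>n A. 1 \<le> n \<and> rank_le_one_family n m A \<longrightarrow>
        norm_of_sum n m A \<le> sqrt (real m) * norm_of_abs_sum n m A) \<and>
     (bdd_above (norm_ratios m) \<and> Sup (norm_ratios m) = sqrt (real m)) \<and>
     (\<forall>n A. 1 \<le> n \<and> rank_le_one_family n m A \<longrightarrow>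
        (norm_of_sum n m A = sqrt (real m) * norm_of_abs_sum n m A \<longrightarrow> m \<le> n) \<and>
        (m \<le> n \<longrightarrow>
          (norm_of_sum n m A = sqrt (real m) * norm_of_abs_sum n m A \<longleftrightarrow>
             (\<forall>k \<in> {1..m}. A k \<noteq> 0\<^sub>m n n) \<and>
             (\<exists>s. \<forall>k \<in> {1..m}. singular_values (A k) - {0} = {s}) \<and>
             (\<exists>W. subspace_dim n W = 1 \<and> (\<forall>k \<in> {1..m}. mat_range (A k) = W)) \<and>
             (\<exists>v. (\<forall>k \<in> {1..m}. right_vector (A k) (v k)) \<and>
                  (\<forall>j \<in> {1..m}. \<forall>k \<in> {1..m}. j \<noteq> k \<longrightarrow> v j \<bullet>c v k = 0))) \<and>
          (norm_of_sum n m A = sqrt (real m) * norm_of_abs_sum n m A \<longleftrightarrow>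
             (\<exists>r > 0. \<exists>u \<in> carrier_vec n. \<exists>v.
                vec_norm2 u = 1 \<and>
                (\<forall>k \<in> {1..m}. v k \<in> carrier_vec n) \<and>
                (\<forall>j \<in> {1..m}. \<forall>k \<in> {1..m}. v j \<bullet>c v k = (if j = k then 1 else 0)) \<and>
                (\<forall>k \<in> {1..m}. A k = complex_of_real r \<cdot>\<^sub>m outer_prod u (v k))))))"
proof -
  have m: "0 < m" using assms by simp
  have bound: "norm_of_sum n m A \<le> sqrt (real m) * norm_of_abs_sum n m A"
    and pos: "0 < norm_of_abs_sum n m A"
    and eq_iff: "norm_of_sum n m A = sqrt (real m) * norm_of_abs_sum n m A \<longleftrightarrow> extremal_family n m A"
    if fam: "1 \<le> n" "rank_le_one_family n m A" for n A
  proof -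
    have n: "0 < n" using fam(1) by simp
    obtain r u v where "dyad_family n m A r u v"
      using rank_le_one_family_imp_dyad_family[OF fam(2) n] by blast
    then interpret dyad_family n m A r u v .
    show "norm_of_sum n m A \<le> sqrt (real m) * norm_of_abs_sum n m A" by (rule op_norm_S_le)
    show "0 < norm_of_abs_sum n m A" by (rule M_pos)
    show "norm_of_sum n m A = sqrt (real m) * norm_of_abs_sum n m A \<longleftrightarrow> extremal_family n m A"
      using equality_imp_extremal extremal_family_imp_equality[OF _ n m] by blast
  qed
  have carrier: "A k \<in> carrier_mat n n" if "rank_le_one_family n m A" "k \<in> {1..m}" for n A k
    using that by (auto simp: rank_le_one_family_def)
  have le: "q \<le> sqrt (real m)" if "q \<in> norm_ratios m" for q
    using that bound pos by (auto simp: divide_le_eq)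
  have mem: "sqrt (real m) \<in> norm_ratios m"
  proof -
    let ?A = "standard_row_family m"
    have fam: "1 \<le> m" "rank_le_one_family m m ?A"
      using m rank_le_one_standard_row_family[OF m] by auto
    have "norm_of_sum m m ?A = sqrt (real m) * norm_of_abs_sum m m ?A"
      using eq_iff[OF fam] extremal_standard_row_family[OF m] by simp
    then have "sqrt (real m) = norm_of_sum m m ?A / norm_of_abs_sum m m ?A"
      using pos[OF fam] by simp
    then show ?thesis using fam by blast
  qed
  show ?thesis
  proof (intro conjI allI impI; (elim conjE)?)
    show "bdd_above (norm_ratios m)" using le by (rule bdd_aboveI)
    show "Sup (norm_ratios m) = sqrt (real m)" using mem le by (rule cSup_eq_maximum)
  next
    fix n A assume "1 \<le> n" "rank_le_one_family n m A"
    then show "norm_of_sum n m A \<le> sqrt (real m) * norm_of_abs_sum n m A" by (rule bound)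
  next
    fix n A assume "1 \<le> n" "rank_le_one_family n m A"
      and "norm_of_sum n m A = sqrt (real m) * norm_of_abs_sum n m A"
    then show "m \<le> n" using eq_iff extremal_family_card_le by blast
  next
    fix n A assume "1 \<le> n" and fam: "rank_le_one_family n m A"
    show "norm_of_sum n m A = sqrt (real m) * norm_of_abs_sum n m A \<longleftrightarrow>
      (\<forall>k \<in> {1..m}. A k \<noteq> 0\<^sub>m n n) \<and>
      (\<exists>s. \<forall>k \<in> {1..m}. singular_values (A k) - {0} = {s}) \<and>
      (\<exists>W. subspace_dim n W = 1 \<and> (\<forall>k \<in> {1..m}. mat_range (A k) = W)) \<and>
      (\<exists>v. (\<forall>k \<in> {1..m}. right_vector (A k) (v k)) \<and>
           (\<forall>j \<in> {1..m}. \<forall>k \<in> {1..m}. j \<noteq> k \<longrightarrow> v j \<bullet>c v k = 0))"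
      unfolding eq_iff[OF \<open>1 \<le> n\<close> fam]
      by (rule extremal_family_iff_intrinsic[OF carrier[OF fam] m])
  next
    fix n A assume "1 \<le> n" and fam: "rank_le_one_family n m A"
    show "norm_of_sum n m A = sqrt (real m) * norm_of_abs_sum n m A \<longleftrightarrow>
      (\<exists>r > 0. \<exists>u \<in> carrier_vec n. \<exists>v.
         vec_norm2 u = 1 \<and>
         (\<forall>k \<in> {1..m}. v k \<in> carrier_vec n) \<and>
         (\<forall>j \<in> {1..m}. \<forall>k \<in> {1..m}. v j \<bullet>c v k = (if j = k then 1 else 0)) \<and>
         (\<forall>k \<in> {1..m}. A k = complex_of_real r \<cdot>\<^sub>m outer_prod u (v k)))"
      unfolding eq_iff[OF \<open>1 \<le> n\<close> fam] by (rule extremal_family_def)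
  qed
qed

end
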